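(* Let $K$ be a field, let $S=K[x_1,\dots,x_n]$, and let $I\subset S$ be a complete intersection monomial ideal minimally generated by $m\ge 1$ elements. Then $$\operatorname{sdepth}(I)=n-\left\lfloor \frac{m}{2}\right\rfloor .$$
   Context: $S=K[x_1,\dots,x_n]$ is the polynomial ring in $n$ variables over the field $K$, with its standard $\mathbb{Z}^n$-grading. A monomial ideal $I\subset S$ is a complete intersection if its unique minimal set $G(I)$ of monomial generators forms a regular sequence (equivalently, the minimal monomial generators are non-units and are pairwise coprime, i.e. no variable divides two of them). "Minimally generated by $m$ elements" means $|G(I)|=m$. Stanley depth: for a monomial $u\in I$ and a subset $Z\subseteq\{x_1,\dots,x_n\}$, the $K$-subspace $uK[Z]$ of $I$ (spanned by all $uw$ with $w$ a monomial in the variables of $Z$) is called a Stanley space. A Stanley decomposition of $I$ is a finite direct sum decomposition $\mathcal{D}: I=\bigoplus_{i=1}^r u_iK[Z_i]$ of $I$ as a $\mathbb{Z}^n$-graded $K$-vector space into Stanley spaces (i.e. every monomial of $I$ lies in exactly one $u_iK[Z_i]$). Its Stanley depth is $\operatorname{sdepth}(\mathcal{D})=\min\{|Z_i| : 1\le i\le r\}$, and $\operatorname{sdepth}(I)$ is the maximum of $\operatorname{sdepth}(\mathcal{D})$ over all Stanley decompositions $\mathcal{D}$ of $I$. *)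

theory Defs
  imports Complex_Main "HOL-Library.Cardinality" "HOL-Library.Poly_Mapping" "HOL-Library.FuncSet"
begin

text \<open>
  The polynomial ring over a field \<open>'k\<close> in variables indexed by the finite type \<open>'n\<close>, as the
  monoid algebra of the exponent vectors. Thus \<open>n = CARD('n)\<close>.
\<close>

type_synonym 'n expo = "'n \<Rightarrow>\<^sub>0 nat"
type_synonym ('n, 'k) mpol = "'n expo \<Rightarrow>\<^sub>0 'k"

global_interpretation ideal: module "(*) :: 'a::comm_ring_1 \<Rightarrow> 'a \<Rightarrow> 'a"
  by unfold_locales (simp_all add: algebra_simps)

text \<open>With this interpretation \<open>ideal.subspace\<close> is the predicate of being an ideal, and
  \<open>ideal.span G\<close> is the ideal generated by \<open>G\<close>.\<close>

definition scalar_mult :: "'k::field \<Rightarrow> ('n, 'k) mpol \<Rightarrow> ('n, 'k) mpol" where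
  "scalar_mult c = Poly_Mapping.map ((*) c)"

global_interpretation mpol: vector_space "scalar_mult :: 'k::field \<Rightarrow> ('n, 'k) mpol \<Rightarrow> ('n, 'k) mpol"
  by unfold_locales
    (simp_all add: scalar_mult_def mult_map_scale_conv_mult single_add distrib_left distrib_right
      mult.assoc [symmetric] mult_single)

definition monomial :: "'n expo \<Rightarrow> ('n, 'k::field) mpol" where
  "monomial a = Poly_Mapping.single a 1"

definition monomial_ideal :: "('n, 'k::field) mpol set \<Rightarrow> bool" where
  "monomial_ideal I \<longleftrightarrow> (\<exists>G \<subseteq> range monomial. I = ideal.span G)"

definition minimal_monomial_generators ::
    "('n, 'k::field) mpol set \<Rightarrow> ('n, 'k) mpol set \<Rightarrow> bool" where
  "minimal_monomial_generators I G \<longleftrightarrow>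
     G \<subseteq> range monomial \<and> ideal.span G = I \<and> (\<forall>H. H \<subset> G \<longrightarrow> ideal.span H \<noteq> I)"

text \<open>The set \<open>G(I)\<close>. It is well defined for every monomial ideal, see
  \<open>ex1_minimal_monomial_generators\<close> below.\<close>

definition min_gens :: "('n, 'k::field) mpol set \<Rightarrow> ('n, 'k) mpol set" where
  "min_gens I = (THE G. minimal_monomial_generators I G)"

text \<open>The first conjunct says that the \<open>i\<close>-th element is a nonzerodivisor modulo the ideal generated
  by the preceding ones.\<close>

definition regular_sequence :: "'a::comm_ring_1 list \<Rightarrow> bool" where
  "regular_sequence fs \<longleftrightarrow>
     (\<forall>i < length fs. \<forall>g. fs ! i * g \<in> ideal.span (set (take i fs))
                            \<longrightarrow> g \<in> ideal.span (set (take i fs))) \<and>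
     ideal.span (set fs) \<noteq> UNIV"

text \<open>For monomials other than \<open>1\<close> regularity does not depend on the order, so asking for one regular
  enumeration of \<open>G(I)\<close> is the same as asking that all of them be regular.\<close>

definition complete_intersection :: "('n, 'k::field) mpol set \<Rightarrow> bool" where
  "complete_intersection I \<longleftrightarrow>
     monomial_ideal I \<and> (\<exists>fs. distinct fs \<and> set fs = min_gens I \<and> regular_sequence fs)"

definition stanley_space :: "'n expo \<Rightarrow> 'n set \<Rightarrow> ('n, 'k::field) mpol set" where
  "stanley_space u Z = mpol.span {monomial u * monomial w | w. Poly_Mapping.keys w \<subseteq> Z}"

definition is_direct_sum ::
    "'a::comm_monoid_add set \<Rightarrow> 'i set \<Rightarrow> ('i \<Rightarrow> 'a set) \<Rightarrow> bool" where
  "is_direct_sum V J W \<longleftrightarrow>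
     (\<forall>j\<in>J. W j \<subseteq> V) \<and> (\<forall>v\<in>V. \<exists>!f. f \<in> Pi\<^sub>E J W \<and> v = (\<Sum>j\<in>J. f j))"

text \<open>The pair \<open>(u, Z)\<close> stands for \<open>uK[Z]\<close>. Stanley spaces are nonzero, so no pair can be repeated
  in a direct sum and a set of pairs suffices; they are spanned by monomials, so the decomposition
  is automatically one of multigraded vector spaces.\<close>

definition stanley_decomposition ::
    "('n, 'k::field) mpol set \<Rightarrow> ('n expo \<times> 'n set) set \<Rightarrow> bool" where
  "stanley_decomposition I D \<longleftrightarrow>
     finite D \<and> (\<forall>(u, Z)\<in>D. monomial u \<in> I) \<and>
     is_direct_sum I D (\<lambda>(u, Z). stanley_space u Z)"

definition sdepth_decomposition :: "('n expo \<times> 'n set) set \<Rightarrow> nat" where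
  "sdepth_decomposition D = Min ((\<lambda>(u, Z). card Z) ` D)"

text \<open>For a nonzero monomial ideal in finitely many variables the maximum is over a nonempty set
  of numbers bounded by \<open>CARD('n)\<close>. For the zero ideal the value is meaningless.\<close>

definition sdepth :: "('n::finite, 'k::field) mpol set \<Rightarrow> nat" where
  "sdepth I = Max {sdepth_decomposition D | D. stanley_decomposition I D}"


subsection \<open>Existence and uniqueness of the minimal monomial generating set\<close>

lemma monomial_eq_iff [simp]: "(monomial a :: ('n, 'k::field) mpol) = monomial b \<longleftrightarrow> a = b"
  unfolding monomial_def
  by (metis lookup_single_eq lookup_single_not_eq one_neq_zero)

lemma monomial_add: "(monomial (a + b) :: ('n, 'k::field) mpol) = monomial a * monomial b"
  by (simp add: monomial_def mult_single)

lemma monomial_in_span_imp: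
  fixes G :: "('n, 'k::field) mpol set"
  assumes G: "G \<subseteq> range monomial" and a: "monomial a \<in> ideal.span G"
  obtains b c where "monomial b \<in> G" "a = b + c"
proof -
  define T :: "('n, 'k) mpol set" where
    "T = {p. \<forall>a \<in> Poly_Mapping.keys p. \<exists>b c. (monomial b :: ('n, 'k) mpol) \<in> G \<and> a = b + c}"
  have "ideal.subspace T"
  proof (rule ideal.subspaceI)
    show "0 \<in> T" by (simp add: T_def)
    show "p + q \<in> T" if "p \<in> T" "q \<in> T" for p q
      using that Poly_Mapping.keys_add [of p q] unfolding T_def by blast
    show "c * p \<in> T" if "p \<in> T" for c p
    proof -
      have "\<exists>b d. (monomial b :: ('n, 'k) mpol) \<in> G \<and> a = b + d"
        if a: "a \<in> Poly_Mapping.keys (c * p)" for a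
      proof -
        obtain x y where "a = x + y" "y \<in> Poly_Mapping.keys p"
          using a keys_mult [of c p] by blast
        moreover from this obtain b d where "(monomial b :: ('n, 'k) mpol) \<in> G" "y = b + d"
          using \<open>p \<in> T\<close> unfolding T_def by blast
        ultimately have "a = b + (x + d)"
          by (simp add: add.left_commute)
        with \<open>monomial b \<in> G\<close> show ?thesis by blast
      qed
      then show ?thesis by (simp add: T_def)
    qed
  qed
  moreover have "G \<subseteq> T"
  proof
    fix g assume g: "g \<in> G"
    then obtain a where "g = monomial a" using G by blast
    moreover have "Poly_Mapping.keys (monomial a :: ('n, 'k) mpol) = {a}"
      by (simp add: monomial_def)
    moreover have "a = a + 0" by simp
    ultimately have "\<forall>a' \<in> Poly_Mapping.keys g. \<exists>b c. (monomial b :: ('n, 'k) mpol) \<in> G \<and> a' = b + c"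
      using g by (metis singletonD)
    then show "g \<in> T" by (simp add: T_def)
  qed
  ultimately have "monomial a \<in> T"
    using a ideal.span_minimal by blast
  then show ?thesis
    using that by (auto simp: T_def monomial_def)
qed

lemma expo_add_eq_0_iff: "(a :: 'n expo) + b = 0 \<longleftrightarrow> a = 0 \<and> b = 0"
proof
  assume "a + b = 0"
  then have "Poly_Mapping.lookup a i + Poly_Mapping.lookup b i = 0" for i
    by (metis lookup_add lookup_zero)
  then show "a = 0 \<and> b = 0"
    by (intro conjI poly_mapping_eqI) simp_all
qed simp

lemma minimal_monomial_generators_subset:
  fixes G H :: "('n, 'k::field) mpol set"
  assumes G: "minimal_monomial_generators I G" and H: "minimal_monomial_generators I H"
  shows "G \<subseteq> H"
proof
  fix g assume g: "g \<in> G"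
  then obtain a where a: "g = monomial a"
    using G unfolding minimal_monomial_generators_def by blast
  have "monomial a \<in> ideal.span H"
    using G H g a ideal.span_base [of g G] by (simp add: minimal_monomial_generators_def)
  then obtain b c where b: "monomial b \<in> H" "a = b + c"
    using monomial_in_span_imp H unfolding minimal_monomial_generators_def by metis
  have "monomial b \<in> ideal.span G"
    using G H b ideal.span_base [of "monomial b" H] by (simp add: minimal_monomial_generators_def)
  then obtain b' c' where b': "monomial b' \<in> G" "b = b' + c'"
    using monomial_in_span_imp G unfolding minimal_monomial_generators_def by metis
  have "b' = a"
  proof (rule ccontr)
    assume "b' \<noteq> a"
    then have "(monomial b' :: ('n, 'k) mpol) \<in> G - {g}" using b' a by simp
    then have "monomial (c' + c) * monomial b' \<in> ideal.span (G - {g})"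
      by (intro ideal.span_scale ideal.span_base)
    then have "g \<in> ideal.span (G - {g})"
      unfolding monomial_add [symmetric] using a b b' by (simp add: ac_simps)
    then have "G \<subseteq> ideal.span (G - {g})"
      by (auto intro: ideal.span_base)
    then have "ideal.span (G - {g}) = ideal.span G"
      by (metis Diff_subset ideal.span_mono ideal.span_span subset_antisym)
    moreover have "G - {g} \<subset> G" using g by blast
    ultimately show False
      using G unfolding minimal_monomial_generators_def by metis
  qed
  then have "a + (c' + c) = a + 0" using b b' by (simp add: ac_simps)
  then have "c' + c = 0" by (simp only: add_left_cancel)
  then have "c = 0" by (simp add: expo_add_eq_0_iff)
  then show "g \<in> H" using a b by simp
qed

lemma ex_minimal_monomial_generators:
  fixes I :: "('n::finite, 'k::field) mpol set"
  assumes "monomial_ideal I"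
  shows "\<exists>G. minimal_monomial_generators I G"
proof -
  obtain G where G: "G \<subseteq> range monomial" "I = ideal.span G"
    using assms unfolding monomial_ideal_def by blast
  define A where "A = {a. (monomial a :: ('n, 'k) mpol) \<in> G}"
  define B where "B = {a \<in> A. \<forall>b c. b \<in> A \<longrightarrow> a = b + c \<longrightarrow> c = 0}"
  define M :: "('n, 'k) mpol set" where "M = monomial ` B"
  define deg :: "'n expo \<Rightarrow> nat" where "deg a = (\<Sum>i\<in>UNIV. Poly_Mapping.lookup a i)" for a
  have deg_add: "deg (a + b) = deg a + deg b" for a b
    by (simp add: deg_def lookup_add sum.distrib)
  have deg_0: "a = 0" if "deg a = 0" for a
    using that by (intro poly_mapping_eqI) (simp add: deg_def)
  have below: "\<exists>b c. b \<in> B \<and> a = b + c" if "a \<in> A" for a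
    using that
  proof (induction "deg a" arbitrary: a rule: less_induct)
    case less
    show ?case
    proof (cases "a \<in> B")
      case True
      then show ?thesis by (intro exI [of _ a] exI [of _ 0]) simp
    next
      case False
      then obtain b c where bc: "b \<in> A" "a = b + c" "c \<noteq> 0"
        using less.prems unfolding B_def by blast
      then have "deg b < deg a" using deg_0 [of c] by (auto simp: deg_add)
      then obtain b' c' where "b' \<in> B" "b = b' + c'"
        using less.hyps bc by blast
      then show ?thesis using bc by (metis add.assoc)
    qed
  qed
  have MG: "M \<subseteq> G" by (auto simp: M_def B_def A_def)
  have "G \<subseteq> ideal.span M"
  proof
    fix g assume g: "g \<in> G"
    then obtain a where a: "g = monomial a" using G by blast
    then obtain b c where bc: "b \<in> B" "a = b + c" using below [of a] g unfolding A_def by blast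
    then have "monomial c * monomial b \<in> ideal.span M"
      by (intro ideal.span_scale ideal.span_base) (simp add: M_def)
    then show "g \<in> ideal.span M" using a bc by (simp add: monomial_add mult.commute)
  qed
  then have span: "ideal.span M = I"
    using MG G by (metis ideal.span_mono ideal.span_span subset_antisym)
  have "ideal.span H \<noteq> I" if H: "H \<subset> M" for H
  proof
    assume *: "ideal.span H = I"
    obtain a where a: "a \<in> B" "monomial a \<notin> H" using H by (auto simp: M_def)
    have "monomial a \<in> ideal.span H" using a * span ideal.span_base [of "monomial a" M] by (simp add: M_def)
    moreover have "H \<subseteq> range monomial" using H M_def by blast
    ultimately obtain b c where b: "monomial b \<in> H" "a = b + c" using monomial_in_span_imp by metis
    then have "b \<in> A" using H MG by (auto simp: A_def)
    then have "c = 0" using a b unfolding B_def by blast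
    then show False using a b by simp
  qed
  moreover have "M \<subseteq> range monomial" by (auto simp: M_def)
  ultimately show ?thesis
    using span unfolding minimal_monomial_generators_def by blast
qed

lemma ex1_minimal_monomial_generators:
  fixes I :: "('n::finite, 'k::field) mpol set"
  assumes "monomial_ideal I"
  shows "\<exists>!G. minimal_monomial_generators I G"
  using ex_minimal_monomial_generators [OF assms]
  by (blast dest: minimal_monomial_generators_subset)

end

theory Submission
  imports Defs "HOL-Library.Countable"
begin

text \<open>
  A Stanley decomposition of a monomial ideal is the same thing as a partition of its exponent vectors
  into cones \<open>u + \<nat>\<^sup>Z\<close>, so the claim is combinatorial. For a complete intersection the generators
  \<open>u\<^sub>0, \<dots>, u\<^sub>m\<^sub>-\<^sub>1\<close> have nonempty, pairwise disjoint supports.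

  Upper bound. The generator \<open>u\<^sub>i\<close> can only lie in a cone \<open>(u\<^sub>i, Z\<^sub>i)\<close> with apex \<open>u\<^sub>i\<close>. The product of
  \<open>u\<^sub>i\<close> and \<open>u\<^sub>j\<close> lies in at most one of the cones of \<open>u\<^sub>i\<close> and \<open>u\<^sub>j\<close>, so for each pair one of the two
  supports meets the complement of the other set \<open>Z\<close>. By disjointness, the complement of \<open>Z\<^sub>i\<close> meets at
  most \<open>n - |Z\<^sub>i|\<close> supports. If all \<open>|Z\<^sub>i| \<ge> k\<close>, counting pairs gives \<open>m (m - 1) \<le> 2 m (n - k)\<close>, that is
  \<open>k \<le> n - \<lfloor>m/2\<rfloor>\<close> (\<open>cone_partition_bound\<close>).

  Lower bound. Record for an exponent vector \<open>a\<close> the nonempty set of generators that divide it, and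
  partition the nonempty subsets of \<open>{0, \<dots>, m - 1}\<close> into intervals \<open>[A, B]\<close> with \<open>B\<close> missing at most
  \<open>\<lfloor>m/2\<rfloor>\<close> elements. The vectors whose set falls into \<open>[A, B]\<close> are those divisible by the generators in
  \<open>A\<close> and by none outside \<open>B\<close>. Not being divisible by one \<open>u\<^sub>j\<close> is a disjoint union of conditions that each
  fix a single variable: look at the first variable whose exponent is too small. Thus each interval
  yields cones in which at most \<open>\<lfloor>m/2\<rfloor>\<close> variables are missing (\<open>ex_cone_partition\<close>).

  The interval partition is the heart of the matter. For odd \<open>m\<close>, write a subset \<open>S\<close> as a cyclic 0-1 word
  of length \<open>m\<close>. If \<open>S\<close> is nonempty, the circle has exactly one tiling by the tiles \<open>1\<close> and \<open>0*\<close>,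
  where \<open>*\<close> stands for either digit, that matches the word: reading a \<open>1\<close> always ends a tile, so what
  happens after it does not depend on where the reading started. All words that match the same tiling
  form an interval, and its top omits just the \<open>0\<close>s of the tiles \<open>0*\<close>, at most \<open>m/2\<close> of them. The
  zero word matches no tiling, because \<open>m\<close> is odd. For even \<open>m\<close>, append a position that always
  carries the digit \<open>0\<close>; the circle then has odd length \<open>m + 1\<close>, so it has at most \<open>m/2\<close> tiles \<open>0*\<close>. Both
  cases are covered by the scanning automaton of the first section.

  Both partitions are handled as retractions: each object is mapped to the label of its block, and all
  members of a block are shown to have the same label. Disjointness and exhaustion are then automatic.
\<close>

section \<open>An interval partition of the nonempty subsets of an initial segment\<close>

text \<open>
  Whether position \<open>i\<close> is the second half of a tile \<open>0*\<close>, when the indicator word of \<open>S\<close> is read from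
  the left and \<open>b\<close> says this of position \<open>0\<close>. A \<open>0\<close> that starts a tile makes the next position a second
  half; in all other cases the next position starts a new tile.
\<close>

primrec scan :: "bool \<Rightarrow> nat set \<Rightarrow> nat \<Rightarrow> bool" where
  "scan b S 0 = b"
| "scan b S (Suc i) = (i \<notin> S \<and> \<not> scan b S i)"

text \<open>
  The initial state that closes the word up to a circle of odd length. For even \<open>m\<close> the circle has the
  extra digit \<open>0\<close> at position \<open>m\<close>, which flips the state; hence the final state must then differ from
  the initial one.
\<close>

definition start :: "nat \<Rightarrow> nat set \<Rightarrow> bool" where
  "start m S \<longleftrightarrow> (scan False S m \<longleftrightarrow> odd m)"

abbreviation free_at :: "nat \<Rightarrow> nat set \<Rightarrow> nat \<Rightarrow> bool" where
  "free_at m S \<equiv> scan (start m S) S"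

text \<open>
  The ends of the interval of all sets that have the same tiling as \<open>S\<close>: the tiles \<open>1\<close> are forced to
  lie in the set, and the first digits of the tiles \<open>0*\<close> are forced to stay outside.
\<close>

definition lower :: "nat \<Rightarrow> nat set \<Rightarrow> nat set" where
  "lower m S = {i \<in> S. \<not> free_at m S i}"

definition upper :: "nat \<Rightarrow> nat set \<Rightarrow> nat set" where
  "upper m S = {i. i < m \<and> (i \<in> S \<or> free_at m S i)}"

text \<open>
  After a \<open>1\<close> the automaton is in the state \<open>False\<close>, whichever state it was in before.
\<close>

lemma scan_forgets_start:
  assumes "i \<in> S" "i < k"
  shows "scan b S k = scan b' S k"
  using assms(2)
proof (induction k)
  case (Suc k)
  with assms(1) show ?case by (cases "i = k") auto
qed simp

lemma scan_empty: "scan b {} k \<longleftrightarrow> (b \<longleftrightarrow> even k)"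
  by (induction k) auto

text \<open>
  By \<open>scan_forgets_start\<close> the final state is a constant function of the initial one, so the closing
  condition determines the initial state.
\<close>

lemma start_unique:
  assumes "S \<subseteq> {..<m}" "S \<noteq> {}"
  shows "(scan b S m = b \<longleftrightarrow> odd m) \<longleftrightarrow> b = start m S"
proof -
  obtain i where "i \<in> S" "i < m" using assms by blast
  then have "scan b S m = scan False S m" by (rule scan_forgets_start)
  then show ?thesis unfolding start_def by auto
qed

text \<open>
  Free positions do not influence the next state, and at the other positions \<open>S\<close> and \<open>T\<close> agree.
\<close>

lemma scan_interval:
  assumes "{i \<in> S. \<not> scan b S i} \<subseteq> T" "T \<subseteq> {i. i < m \<and> (i \<in> S \<or> scan b S i)}" "k \<le> m"
  shows "scan b T k = scan b S k"
  using assms(3)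
proof (induction k)
  case (Suc k)
  then have IH: "scan b T k = scan b S k" by simp
  show ?case
  proof (cases "scan b S k")
    case True
    then show ?thesis using IH by simp
  next
    case False
    then have "k \<in> T \<longleftrightarrow> k \<in> S" using assms(1,2) by blast
    then show ?thesis using IH by simp
  qed
qed simp

lemma lower_subset: "lower m S \<subseteq> S"
  by (auto simp: lower_def)

lemma subset_upper: "S \<subseteq> {..<m} \<Longrightarrow> S \<subseteq> upper m S"
  by (auto simp: upper_def)

text \<open>
  \<open>T\<close> has the scan of \<open>S\<close>, hence its closing initial state and its tiling. That \<open>T\<close> cannot be empty
  is where the odd length of the circle enters: the empty set flips the state at every step, so it
  satisfies the closing condition for no initial state.
\<close>

lemma interval_stable:
  assumes S: "S \<subseteq> {..<m}" "S \<noteq> {}" and T: "lower m S \<subseteq> T" "T \<subseteq> upper m S"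
  shows "T \<noteq> {}" "lower m T = lower m S" "upper m T = upper m S"
proof -
  let ?b = "start m S"
  have same: "scan ?b T k = scan ?b S k" if "k \<le> m" for k
    using T that unfolding lower_def upper_def by (rule scan_interval)
  have fixp: "scan ?b T m = ?b \<longleftrightarrow> odd m"
    using start_unique [OF S] same by auto
  show ne: "T \<noteq> {}"
    using fixp by (cases "T = {}") (auto simp: scan_empty)
  have Tm: "T \<subseteq> {..<m}" using T by (auto simp: upper_def)
  have st: "start m T = ?b"
    using start_unique [OF Tm ne, of ?b] fixp by simp
  have mem: "i \<in> T \<longleftrightarrow> i \<in> S" if "i < m" "\<not> scan ?b S i" for i
    using T that by (auto simp: lower_def upper_def)
  show "lower m T = lower m S"
    using S Tm mem same unfolding lower_def st by (auto simp: less_imp_le subset_iff)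
  show "upper m T = upper m S"
    using mem same unfolding upper_def st by (auto simp: less_imp_le)
qed

text \<open>
  Each counted position makes its successor free, so twice their number is at most the length, up to
  corrections for a tile cut by the left or right end.
\<close>

lemma card_unfree_absent:
  "2 * card {i. i < k \<and> i \<notin> S \<and> \<not> scan b S i} + of_bool b \<le> k + of_bool (scan b S k)"
proof (induction k)
  case (Suc k)
  let ?C = "\<lambda>k. {i. i < k \<and> i \<notin> S \<and> \<not> scan b S i}"
  show ?case
  proof (cases "k \<notin> S \<and> \<not> scan b S k")
    case True
    then have "?C (Suc k) = insert k (?C k)" by (auto simp: less_Suc_eq)
    moreover have "card (insert k (?C k)) = Suc (card (?C k))" by simp
    ultimately show ?thesis using Suc True by simp
  next
    case False
    then have "?C (Suc k) = ?C k" by (auto simp: less_Suc_eq)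
    moreover have "of_bool (scan b S k) \<le> (1 :: nat)" by simp
    ultimately show ?thesis using Suc False by (cases "scan b S k") simp_all
  qed
qed simp

lemma card_above_upper:
  assumes S: "S \<subseteq> {..<m}" "S \<noteq> {}"
  shows "card ({..<m} - upper m S) \<le> m div 2"
proof -
  let ?b = "start m S"
  have "{..<m} - upper m S = {i. i < m \<and> i \<notin> S \<and> \<not> scan ?b S i}"
    by (auto simp: upper_def)
  moreover have "scan ?b S m = ?b \<longleftrightarrow> odd m" using start_unique [OF S] by simp
  moreover have "2 * c \<le> m \<or> even m \<and> 2 * c \<le> m + 1"
    if "2 * c + of_bool ?b \<le> m + of_bool (scan ?b S m)" "scan ?b S m = ?b \<longleftrightarrow> odd m" for c
    using that by (cases ?b; cases "scan ?b S m") simp_all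
  ultimately have "2 * card ({..<m} - upper m S) \<le> m \<or> even m \<and> 2 * card ({..<m} - upper m S) \<le> m + 1"
    using card_unfree_absent [of m S ?b] by metis
  then show ?thesis by presburger
qed

section \<open>Stanley decompositions as partitions into cones\<close>

definition cone :: "'n expo \<Rightarrow> 'n set \<Rightarrow> 'n expo set" where
  "cone u Z = {a. (\<forall>x. Poly_Mapping.lookup u x \<le> Poly_Mapping.lookup a x) \<and>
                  (\<forall>x. x \<notin> Z \<longrightarrow> Poly_Mapping.lookup a x = Poly_Mapping.lookup u x)}"

definition divides :: "'n expo \<Rightarrow> 'n expo \<Rightarrow> bool" where
  "divides a b \<longleftrightarrow> (\<forall>x. Poly_Mapping.lookup a x \<le> Poly_Mapping.lookup b x)"

lemma divides_iff_add: "divides a b \<longleftrightarrow> (\<exists>c. b = a + c)"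
proof
  assume "divides a b"
  then have "b = a + (b - a)"
    by (intro poly_mapping_eqI) (simp add: divides_def lookup_add lookup_minus)
  then show "\<exists>c. b = a + c" ..
qed (auto simp: divides_def lookup_add)

lemma cone_eq_shift: "cone u Z = {u + w | w. Poly_Mapping.keys w \<subseteq> Z}"
proof (intro equalityI subsetI)
  fix a assume a: "a \<in> cone u Z"
  then have "a = u + (a - u)"
    by (intro poly_mapping_eqI) (simp add: cone_def lookup_add lookup_minus)
  moreover have "Poly_Mapping.keys (a - u) \<subseteq> Z"
    using a by (auto simp: cone_def in_keys_iff lookup_minus)
  ultimately show "a \<in> {u + w | w. Poly_Mapping.keys w \<subseteq> Z}" by blast
qed (auto simp: cone_def lookup_add in_keys_iff)

lemma apex_in_cone: "u \<in> cone u Z"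
  by (simp add: cone_def)

lemma mpol_in_mpol_span:
  fixes p :: "('n, 'k::field) mpol"
  assumes "Poly_Mapping.keys p \<subseteq> A"
  shows "p \<in> mpol.span (monomial ` A)"
proof -
  have "p = (\<Sum>a\<in>Poly_Mapping.keys p. scalar_mult (Poly_Mapping.lookup p a) (monomial a))"
    by (rule poly_mapping_eqI)
      (simp add: scalar_mult_def monomial_def lookup_sum map.rep_eq lookup_single when_def in_keys_iff)
  also have "\<dots> \<in> mpol.span (monomial ` A)"
    using assms by (intro mpol.span_sum mpol.span_scale mpol.span_base) auto
  finally show ?thesis .
qed

lemma keys_monomial [simp]: "Poly_Mapping.keys (monomial a :: ('n, 'k::field) mpol) = {a}"
  by (simp add: monomial_def)

lemma stanley_space_eq:
  "(stanley_space u Z :: ('n, 'k::field) mpol set) = {p. Poly_Mapping.keys p \<subseteq> cone u Z}"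
proof -
  have gens: "{monomial u * monomial w | w. Poly_Mapping.keys w \<subseteq> Z}
      = (monomial ` cone u Z :: ('n, 'k) mpol set)"
    unfolding cone_eq_shift monomial_add [symmetric] by auto
  have "mpol.subspace {p :: ('n, 'k) mpol. Poly_Mapping.keys p \<subseteq> cone u Z}"
  proof (rule mpol.subspaceI)
    fix p q :: "('n, 'k) mpol" and c :: 'k
    assume p: "p \<in> {p. Poly_Mapping.keys p \<subseteq> cone u Z}"
    then show "scalar_mult c p \<in> {p. Poly_Mapping.keys p \<subseteq> cone u Z}"
      by (auto simp: scalar_mult_def in_keys_iff map.rep_eq when_def subset_iff)
    assume "q \<in> {p. Poly_Mapping.keys p \<subseteq> cone u Z}"
    then show "p + q \<in> {p. Poly_Mapping.keys p \<subseteq> cone u Z}"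
      using p Poly_Mapping.keys_add [of p q] by blast
  qed simp
  then have "mpol.span (monomial ` cone u Z) \<subseteq> {p :: ('n, 'k) mpol. Poly_Mapping.keys p \<subseteq> cone u Z}"
    by (intro mpol.span_minimal) auto
  then show ?thesis
    unfolding stanley_space_def gens by (auto intro: mpol_in_mpol_span)
qed

definition exponents :: "('n, 'k::field) mpol set \<Rightarrow> 'n expo set" where
  "exponents I = {a. monomial a \<in> I}"

lemma monomial_ideal_eq:
  fixes I :: "('n, 'k::field) mpol set"
  assumes "monomial_ideal I"
  shows "I = {p. Poly_Mapping.keys p \<subseteq> exponents I}"
proof -
  obtain G where G: "G \<subseteq> range monomial" "I = ideal.span G"
    using assms unfolding monomial_ideal_def by blast
  have mult: "q * p \<in> I" if "p \<in> I" for p q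
    using that G ideal.span_scale by blast
  have "ideal.subspace {p :: ('n, 'k) mpol. Poly_Mapping.keys p \<subseteq> exponents I}"
  proof (rule ideal.subspaceI)
    fix p q :: "('n, 'k) mpol"
    assume p: "p \<in> {p. Poly_Mapping.keys p \<subseteq> exponents I}"
    have "a \<in> exponents I" if a: "a \<in> Poly_Mapping.keys (q * p)" for a
    proof -
      obtain x y where "a = x + y" "y \<in> Poly_Mapping.keys p"
        using a keys_mult [of q p] by blast
      with p show ?thesis
        using mult by (auto simp: exponents_def monomial_add)
    qed
    then show "q * p \<in> {p. Poly_Mapping.keys p \<subseteq> exponents I}" by blast
    assume "q \<in> {p. Poly_Mapping.keys p \<subseteq> exponents I}"
    then show "p + q \<in> {p. Poly_Mapping.keys p \<subseteq> exponents I}"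
      using p Poly_Mapping.keys_add [of p q] by blast
  qed simp
  moreover have "G \<subseteq> {p. Poly_Mapping.keys p \<subseteq> exponents I}"
    using G ideal.span_base [of _ G] by (auto simp: exponents_def)
  ultimately have "I \<subseteq> {p. Poly_Mapping.keys p \<subseteq> exponents I}"
    using G ideal.span_minimal by blast
  moreover have "p \<in> I" if "Poly_Mapping.keys p \<subseteq> exponents I" for p
  proof -
    have "mpol.subspace I"
      using G mult by (intro mpol.subspaceI)
        (auto simp: scalar_mult_def mult_map_scale_conv_mult ideal.span_zero ideal.span_add)
    moreover have "monomial ` exponents I \<subseteq> I" by (auto simp: exponents_def)
    ultimately have "mpol.span (monomial ` exponents I) \<subseteq> I" using mpol.span_minimal by blast
    then show ?thesis using mpol_in_mpol_span [OF that] by blast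
  qed
  ultimately show ?thesis by blast
qed

definition cone_partition :: "'n expo set \<Rightarrow> ('n expo \<times> 'n set) set \<Rightarrow> bool" where
  "cone_partition E D \<longleftrightarrow>
    finite D \<and> (\<forall>(u, Z)\<in>D. cone u Z \<subseteq> E) \<and> (\<forall>a\<in>E. \<exists>!d. d \<in> D \<and> a \<in> cone (fst d) (snd d))"

text \<open>
  A decomposition of the monomial \<open>x\<^sup>a\<close> shows that some cone contains \<open>a\<close>. If two cones contained
  \<open>a\<close>, then \<open>x\<^sup>a\<close> placed in one summand or in the other would give two decompositions. Conversely, for a
  partition the component of a polynomial in a summand must be its restriction to the cone.
\<close>

lemma stanley_decomposition_iff:
  fixes I :: "('n, 'k::field) mpol set"
  assumes I: "monomial_ideal I"
  shows "stanley_decomposition I D \<longleftrightarrow> cone_partition (exponents I) D"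
proof
  let ?W = "\<lambda>(u, Z). stanley_space u Z :: ('n, 'k) mpol set"
  have W: "?W d = {p. Poly_Mapping.keys p \<subseteq> cone (fst d) (snd d)}" for d
    by (cases d) (simp add: stanley_space_eq)
  {
    assume "stanley_decomposition I D"
    then have fin: "finite D"
      and sub: "\<And>d. d \<in> D \<Longrightarrow> ?W d \<subseteq> I"
      and ex1: "\<And>p. p \<in> I \<Longrightarrow> \<exists>!f. f \<in> Pi\<^sub>E D ?W \<and> p = (\<Sum>d\<in>D. f d)"
      unfolding stanley_decomposition_def is_direct_sum_def by blast+
    have "cone u Z \<subseteq> exponents I" if "(u, Z) \<in> D" for u Z
    proof
      fix a assume "a \<in> cone u Z"
      then have "monomial a \<in> ?W (u, Z)" by (simp add: stanley_space_eq)
      then show "a \<in> exponents I" using sub [OF that] by (auto simp: exponents_def)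
    qed
    moreover have "\<exists>!d. d \<in> D \<and> a \<in> cone (fst d) (snd d)" if a: "a \<in> exponents I" for a
    proof -
      let ?p = "monomial a :: ('n, 'k) mpol"
      have p: "?p \<in> I" using a by (simp add: exponents_def)
      obtain f where f: "f \<in> Pi\<^sub>E D ?W" "?p = (\<Sum>d\<in>D. f d)" using ex1 [OF p] by blast
      have "a \<in> Poly_Mapping.keys (\<Sum>d\<in>D. f d)" using f(2) [symmetric] by simp
      then obtain d where d: "d \<in> D" "a \<in> Poly_Mapping.keys (f d)"
        using Poly_Mapping.keys_sum [of f D] by blast
      then have "a \<in> cone (fst d) (snd d)" using PiE_mem [OF f(1) d(1)] unfolding W by blast
      moreover have "d' = d''"
        if d': "d' \<in> D" "a \<in> cone (fst d') (snd d')" and d'': "d'' \<in> D" "a \<in> cone (fst d'') (snd d'')"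
        for d' d''
      proof -
        define g where "g e = (\<lambda>d\<in>D. if d = e then ?p else 0)" for e
        have g: "g e \<in> Pi\<^sub>E D ?W \<and> ?p = (\<Sum>d\<in>D. g e d)" if "e \<in> D" "a \<in> cone (fst e) (snd e)" for e
          using that fin unfolding W g_def by (auto simp: PiE_iff)
        have "g d' = g d''" using ex1 [OF p] g [OF d'] g [OF d''] by blast
        then have "g d' d' = g d'' d'" by simp
        moreover have "?p \<noteq> 0" by (metis keys_monomial keys_zero insert_not_empty)
        ultimately show ?thesis using d'(1) by (auto simp: g_def split: if_splits)
      qed
      ultimately show ?thesis using d(1) by blast
    qed
    ultimately show "cone_partition (exponents I) D"
      using fin unfolding cone_partition_def by blast
  }
  assume "cone_partition (exponents I) D"
  then have fin: "finite D" and sub: "\<And>d. d \<in> D \<Longrightarrow> cone (fst d) (snd d) \<subseteq> exponents I"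
    and ex1: "\<And>a. a \<in> exponents I \<Longrightarrow> \<exists>!d. d \<in> D \<and> a \<in> cone (fst d) (snd d)"
    by (simp_all add: cone_partition_def case_prod_beta)
  note Ieq = monomial_ideal_eq [OF I]
  have WI: "?W d \<subseteq> I" if "d \<in> D" for d
    using sub [OF that] Ieq unfolding W by blast
  moreover have "\<exists>!f. f \<in> Pi\<^sub>E D ?W \<and> p = (\<Sum>d\<in>D. f d)" if p: "p \<in> I" for p
  proof -
    define f :: "_ \<Rightarrow> ('n, 'k) mpol" where
      "f = (\<lambda>d\<in>D. Abs_poly_mapping (\<lambda>a. Poly_Mapping.lookup p a when a \<in> cone (fst d) (snd d)))"
    have lf: "Poly_Mapping.lookup (f d) a = (Poly_Mapping.lookup p a when a \<in> cone (fst d) (snd d))"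
      if "d \<in> D" for d a
    proof -
      have "finite {a. (Poly_Mapping.lookup p a when a \<in> cone (fst d) (snd d)) \<noteq> 0}"
        by (rule finite_subset [OF _ finite_keys [of p]]) (auto simp: when_def in_keys_iff)
      then show ?thesis using that by (simp add: f_def lookup_Abs_poly_mapping)
    qed
    have coeff: "Poly_Mapping.lookup (\<Sum>d\<in>D. g d) a = Poly_Mapping.lookup (g e) a"
      if g: "g \<in> Pi\<^sub>E D ?W" and e: "e \<in> D" "a \<in> cone (fst e) (snd e)" for g :: "_ \<Rightarrow> ('n, 'k) mpol" and e a
    proof -
      have "Poly_Mapping.lookup (g d) a = 0" if d: "d \<in> D" "d \<noteq> e" for d
      proof -
        have "a \<in> exponents I" using sub e by blast
        then have "a \<notin> cone (fst d) (snd d)" using ex1 [of a] d e by blast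
        then show ?thesis using PiE_mem [OF g d(1)] unfolding W by (auto simp: in_keys_iff)
      qed
      then have "(\<Sum>d\<in>D - {e}. Poly_Mapping.lookup (g d) a) = 0"
        by (intro sum.neutral) blast
      then show ?thesis
        using sum.remove [OF fin e(1), of "\<lambda>d. Poly_Mapping.lookup (g d) a"] by (simp add: lookup_sum)
    qed
    have fP: "f \<in> Pi\<^sub>E D ?W"
    proof (rule PiE_I)
      show "f d \<in> ?W d" if "d \<in> D" for d
        using that unfolding W by (auto simp: lf in_keys_iff when_def split: if_splits)
    qed (simp add: f_def)
    have "p = (\<Sum>d\<in>D. f d)"
    proof (rule poly_mapping_eqI)
      fix a
      show "Poly_Mapping.lookup p a = Poly_Mapping.lookup (\<Sum>d\<in>D. f d) a"
      proof (cases "a \<in> exponents I")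
        case True
        then obtain e where e: "e \<in> D" "a \<in> cone (fst e) (snd e)" using ex1 by blast
        then show ?thesis using coeff [OF fP e] lf by simp
      next
        case False
        moreover have "Poly_Mapping.keys p \<subseteq> exponents I" using p by (subst (asm) Ieq) simp
        ultimately have "Poly_Mapping.lookup p a = 0" by (auto simp: in_keys_iff)
        then show ?thesis by (simp add: lookup_sum lf)
      qed
    qed
    moreover have "g = f" if g: "g \<in> Pi\<^sub>E D ?W" "p = (\<Sum>d\<in>D. g d)" for g
    proof (rule PiE_ext [OF g(1) fP])
      fix d assume d: "d \<in> D"
      show "g d = f d"
      proof (rule poly_mapping_eqI)
        fix a
        show "Poly_Mapping.lookup (g d) a = Poly_Mapping.lookup (f d) a"
        proof (cases "a \<in> cone (fst d) (snd d)")
          case True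
          then show ?thesis using coeff [OF g(1) d True] g(2) lf [OF d] by simp
        next
          case False
          then show ?thesis using PiE_mem [OF g(1) d] lf [OF d] unfolding W by (auto simp: in_keys_iff)
        qed
      qed
    qed
    ultimately show ?thesis using fP by blast
  qed
  moreover have "monomial u \<in> I" if "(u, Z) \<in> D" for u Z
    using sub [OF that] apex_in_cone [of u Z] by (auto simp: exponents_def)
  ultimately show "stanley_decomposition I D"
    unfolding stanley_decomposition_def is_direct_sum_def using fin by blast
qed

section \<open>The exponents of a complete intersection\<close>

text \<open>
  A generator that is a proper multiple of another one could be dropped.
\<close>

lemma minimal_generators_antichain:
  fixes G :: "('n, 'k::field) mpol set"
  assumes G: "minimal_monomial_generators I G"
    and a: "monomial a \<in> G" and b: "monomial b \<in> G" and dvd: "divides b a"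
  shows "b = a"
proof (rule ccontr)
  assume "b \<noteq> a"
  then have "(monomial b :: ('n, 'k) mpol) \<in> G - {monomial a}" using b by simp
  moreover obtain c where c: "a = b + c" using dvd by (auto simp: divides_iff_add)
  ultimately have "monomial c * monomial b \<in> ideal.span (G - {monomial a})"
    by (intro ideal.span_scale ideal.span_base)
  then have "monomial a \<in> ideal.span (G - {monomial a})"
    by (simp add: c monomial_add mult.commute)
  then have "G \<subseteq> ideal.span (G - {monomial a})"
    by (auto intro: ideal.span_base)
  then have "ideal.span (G - {monomial a}) = ideal.span G"
    by (metis Diff_subset ideal.span_mono ideal.span_span subset_antisym)
  moreover have "G - {monomial a} \<subset> G" using a by blast
  ultimately show False using G unfolding minimal_monomial_generators_def by metis
qed

locale coprime_exponents =
  fixes u :: "nat \<Rightarrow> 'n::finite expo" and m :: nat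
  assumes support_nonempty: "i < m \<Longrightarrow> Poly_Mapping.keys (u i) \<noteq> {}"
    and support_disjoint: "i < m \<Longrightarrow> j < m \<Longrightarrow> x \<in> Poly_Mapping.keys (u i) \<Longrightarrow>
      x \<in> Poly_Mapping.keys (u j) \<Longrightarrow> i = j"
begin

definition multiples :: "'n expo set" where
  "multiples = {a. \<exists>i<m. divides (u i) a}"

end

text \<open>
  Suppose \<open>u\<^sub>i\<close> and \<open>u\<^sub>j\<close> with \<open>i < j\<close> have a common variable. Then \<open>u\<^sub>i / gcd u\<^sub>i u\<^sub>j\<close> times \<open>u\<^sub>j\<close> is the
  least common multiple, a multiple of \<open>u\<^sub>i\<close>. Regularity puts \<open>u\<^sub>i / gcd u\<^sub>i u\<^sub>j\<close> into the ideal of the earlier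
  generators, so one of them divides a proper divisor of \<open>u\<^sub>i\<close>, against minimality. No support is empty
  since the ideal is proper.
\<close>

lemma complete_intersection_coprime_exponents:
  fixes I :: "('n::finite, 'k::field) mpol set"
  assumes "complete_intersection I"
  obtains u where "coprime_exponents u (card (min_gens I))"
    "exponents I = coprime_exponents.multiples u (card (min_gens I))"
proof -
  define m where "m = card (min_gens I)"
  obtain fs where I: "monomial_ideal I" and fs: "distinct fs" "set fs = min_gens I" "regular_sequence fs"
    using assms unfolding complete_intersection_def by blast
  have G: "minimal_monomial_generators I (set fs)"
    unfolding fs(2) min_gens_def by (rule theI' [OF ex1_minimal_monomial_generators [OF I]])
  then have mons: "set fs \<subseteq> range monomial" and span: "ideal.span (set fs) = I"
    by (simp_all add: minimal_monomial_generators_def)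
  have len: "length fs = m" unfolding m_def using fs distinct_card by metis
  have "\<exists>a. fs ! i = monomial a" if "i < m" for i
  proof -
    have "fs ! i \<in> set fs" using that len by simp
    then show ?thesis using mons by blast
  qed
  then obtain u where u: "\<And>i. i < m \<Longrightarrow> fs ! i = monomial (u i)" by metis
  have disj: False
    if ij: "i < j" "j < m" and x: "x \<in> Poly_Mapping.keys (u i)" "x \<in> Poly_Mapping.keys (u j)" for i j x
  proof -
    let ?J = "ideal.span (set (take j fs))"
    have "fs ! i \<in> set (take j fs)" using ij len by (auto simp: in_set_conv_nth)
    then have "monomial (u j - u i) * fs ! i \<in> ?J"
      by (intro ideal.span_scale ideal.span_base)
    \<comment> \<open>Subtraction of exponent vectors is truncated: \<open>u i - u j\<close> is \<open>u i / gcd (u i) (u j)\<close>, and both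
      sides are the least common multiple.\<close>
    moreover have "u j + (u i - u j) = (u j - u i) + u i"
      by (intro poly_mapping_eqI) (simp add: lookup_add lookup_minus)
    then have "fs ! j * monomial (u i - u j) = monomial (u j - u i) * fs ! i"
      using ij u by (simp flip: monomial_add)
    ultimately have "monomial (u i - u j) \<in> ?J"
      using fs(3) ij len unfolding regular_sequence_def by metis
    moreover have "set (take j fs) \<subseteq> range monomial"
      using mons set_take_subset [of j fs] by blast
    ultimately obtain d c where d: "monomial d \<in> set (take j fs)" "u i - u j = d + c"
      using monomial_in_span_imp by metis
    have lk: "Poly_Mapping.lookup (u i) y - Poly_Mapping.lookup (u j) y
        = Poly_Mapping.lookup d y + Poly_Mapping.lookup c y" for y
      using d(2) by (metis lookup_add lookup_minus)
    have "Poly_Mapping.lookup d y \<le> Poly_Mapping.lookup (u i) y" for y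
      using lk [of y] by linarith
    then have "divides d (u i)" by (simp add: divides_def)
    moreover have "monomial d \<in> set fs" using d(1) set_take_subset [of j fs] by blast
    moreover have "monomial (u i) \<in> set fs" using ij len u [of i] nth_mem [of i fs] by simp
    ultimately have "d = u i" using minimal_generators_antichain [OF G] by blast
    then show False using lk [of x] x by (simp add: in_keys_iff)
  qed
  have "coprime_exponents u m"
  proof
    fix i assume i: "i < m"
    show "Poly_Mapping.keys (u i) \<noteq> {}"
    proof
      assume "Poly_Mapping.keys (u i) = {}"
      then have "fs ! i = 1" using u [OF i] by (simp add: monomial_def)
      then have "1 \<in> ideal.span (set fs)"
        using i len nth_mem [of i fs] ideal.span_base [of "fs ! i" "set fs"] by simp
      then have "p * 1 \<in> ideal.span (set fs)" for p by (rule ideal.span_scale)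
      then have "ideal.span (set fs) = UNIV" by auto
      then show False using fs(3) by (simp add: regular_sequence_def)
    qed
  next
    fix i j x
    assume "i < m" "j < m" "x \<in> Poly_Mapping.keys (u i)" "x \<in> Poly_Mapping.keys (u j)"
    then show "i = j" using disj [of i j x] disj [of j i x] by (cases i j rule: linorder_cases) auto
  qed
  moreover have "exponents I = coprime_exponents.multiples u m"
    unfolding coprime_exponents.multiples_def [OF \<open>coprime_exponents u m\<close>]
  proof (intro equalityI subsetI)
    fix a assume "a \<in> exponents I"
    then have "monomial a \<in> ideal.span (set fs)" by (simp add: exponents_def span)
    then obtain b c where b: "monomial b \<in> set fs" "a = b + c"
      using monomial_in_span_imp mons by metis
    then obtain i where "i < m" "fs ! i = monomial b" using len by (auto simp: in_set_conv_nth)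
    then show "a \<in> {a. \<exists>i<m. divides (u i) a}" using b u by (auto simp: divides_iff_add)
  next
    fix a assume "a \<in> {a. \<exists>i<m. divides (u i) a}"
    then obtain i c where i: "i < m" "a = u i + c" by (auto simp: divides_iff_add)
    then have "monomial c * fs ! i \<in> ideal.span (set fs)"
      using len by (intro ideal.span_scale ideal.span_base) simp
    then show "a \<in> exponents I" using i u by (simp add: exponents_def span monomial_add mult.commute)
  qed
  ultimately show ?thesis using that by (simp add: m_def)
qed

section \<open>The upper bound\<close>

context coprime_exponents
begin

text \<open>
  \<open>R i\<close> below is the set of the other generators whose support is not contained in \<open>Z\<^sub>i\<close>. Every pair of
  generators is recorded in one of its two sets, and \<open>R i\<close> embeds into the complement of \<open>Z\<^sub>i\<close>.
\<close>

lemma cone_partition_bound: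
  assumes D: "cone_partition multiples D" and m: "m \<ge> 1"
    and k: "\<And>v Z. (v, Z) \<in> D \<Longrightarrow> k \<le> card Z"
  shows "k + m div 2 \<le> CARD('n)"
proof -
  have inD: "cone v Z \<subseteq> multiples" if "(v, Z) \<in> D" for v Z
    using D that unfolding cone_partition_def by blast
  have ex1: "\<exists>!d. d \<in> D \<and> a \<in> cone (fst d) (snd d)" if "a \<in> multiples" for a
    using D that unfolding cone_partition_def by blast
  have "\<exists>Z. (u i, Z) \<in> D" if i: "i < m" for i
  proof -
    have "u i \<in> multiples" using i by (auto simp: multiples_def divides_def)
    then obtain v Z where vZ: "(v, Z) \<in> D" "u i \<in> cone v Z" using ex1 by fastforce
    \<comment> \<open>The apex \<open>v\<close> is a multiple of some \<open>u j\<close> and divides \<open>u i\<close>; disjoint supports force \<open>u j = v = u i\<close>.\<close>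
    have "v \<in> multiples" using inD [OF vZ(1)] apex_in_cone by blast
    then obtain j where j: "j < m" "divides (u j) v" by (auto simp: multiples_def)
    have vi: "divides v (u i)" using vZ(2) by (simp add: cone_def divides_def)
    obtain x where x: "x \<in> Poly_Mapping.keys (u j)" using support_nonempty [OF j(1)] by blast
    have "Poly_Mapping.lookup (u j) x \<le> Poly_Mapping.lookup (u i) x"
      using j(2) vi unfolding divides_def by (meson order_trans)
    then have "x \<in> Poly_Mapping.keys (u i)" using x by (simp add: in_keys_iff)
    then have "i = j" using support_disjoint i j(1) x by blast
    then have "v = u i"
      using j(2) vi by (intro poly_mapping_eqI) (simp add: divides_def order_antisym)
    then show ?thesis using vZ(1) by blast
  qed
  then obtain Z where Z: "\<And>i. i < m \<Longrightarrow> (u i, Z i) \<in> D" by metis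
  define R where "R i = {j. j < m \<and> j \<noteq> i \<and> \<not> Poly_Mapping.keys (u j) \<subseteq> Z i}" for i
  have finR: "finite (R i)" for i by (simp add: R_def)
  have pair: "j \<in> R i \<or> i \<in> R j" if ij: "i < m" "j < m" "i \<noteq> j" for i j
  proof (rule ccontr)
    assume "\<not> ?thesis"
    then have "Poly_Mapping.keys (u j) \<subseteq> Z i" "Poly_Mapping.keys (u i) \<subseteq> Z j"
      using ij by (auto simp: R_def)
    then have c: "u i + u j \<in> cone (u i) (Z i)" "u i + u j \<in> cone (u j) (Z j)"
      by (auto simp: cone_def lookup_add in_keys_iff subset_iff)
    have "u i + u j \<in> multiples" using inD [OF Z [OF ij(1)]] c(1) by blast
    then have "\<exists>!d. d \<in> D \<and> u i + u j \<in> cone (fst d) (snd d)" by (rule ex1)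
    moreover have "(u i, Z i) \<in> D" "(u j, Z j) \<in> D" using Z ij by blast+
    ultimately have "(u i, Z i) = (u j, Z j)" using c by (metis fst_conv snd_conv)
    then have "u i = u j" by simp
    moreover obtain x where "x \<in> Poly_Mapping.keys (u i)" using support_nonempty ij by blast
    ultimately show False using support_disjoint [of i j x] ij by simp
  qed
  have cardR: "card (R i) \<le> CARD('n) - k" if i: "i < m" for i
  proof -
    have "\<exists>x. x \<in> Poly_Mapping.keys (u j) - Z i" if "j \<in> R i" for j
      using that by (auto simp: R_def)
    then obtain f where f: "\<And>j. j \<in> R i \<Longrightarrow> f j \<in> Poly_Mapping.keys (u j) - Z i" by metis
    have "inj_on f (R i)"
    proof (rule inj_onI)
      fix j j' assume j: "j \<in> R i" "j' \<in> R i" "f j = f j'"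
      then show "j = j'"
        using support_disjoint [of j j' "f j"] f [of j] f [of j'] by (simp add: R_def)
    qed
    then have "card (R i) \<le> card (- Z i)"
      using f by (intro card_inj_on_le [of f]) auto
    also have "\<dots> = CARD('n) - card (Z i)" by (simp add: Compl_eq_Diff_UNIV card_Diff_subset)
    also have "\<dots> \<le> CARD('n) - k" using k [OF Z [OF i]] by simp
    finally show ?thesis .
  qed
  have kn: "k \<le> CARD('n)"
    using k [OF Z [of 0]] m card_mono [of UNIV "Z 0"] by (simp add: order_trans)
  let ?S = "SIGMA i:{..<m}. R i"
  have fS: "finite ?S" using finR by simp
  have "(SIGMA i:{..<m}. {..<m} - {i}) \<subseteq> ?S \<union> prod.swap ` ?S"
  proof
    fix p assume "p \<in> (SIGMA i:{..<m}. {..<m} - {i})"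
    then obtain i j where p: "p = (i, j)" "i < m" "j < m" "i \<noteq> j" by auto
    show "p \<in> ?S \<union> prod.swap ` ?S"
    proof (cases "j \<in> R i")
      case True
      then show ?thesis using p by simp
    next
      case False
      then have "(j, i) \<in> ?S" using p pair [of i j] by simp
      then show ?thesis using p(1) by (intro UnI2 image_eqI [of _ _ "(j, i)"]) simp_all
    qed
  qed
  then have "card (SIGMA i:{..<m}. {..<m} - {i}) \<le> card (?S \<union> prod.swap ` ?S)"
    using fS by (intro card_mono) auto
  also have "\<dots> \<le> card ?S + card (prod.swap ` ?S)" by (rule card_Un_le)
  also have "\<dots> \<le> 2 * card ?S" using card_image_le [OF fS, of prod.swap] by simp
  also have "card ?S = (\<Sum>i<m. card (R i))" using finR by (simp add: card_SigmaI)
  also have "2 * \<dots> \<le> 2 * (m * (CARD('n) - k))"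
    using sum_bounded_above [of "{..<m}" "\<lambda>i. card (R i)" "CARD('n) - k"] cardR by simp
  finally have "m * (m - 1) \<le> m * (2 * (CARD('n) - k))"
    by (simp add: card_SigmaI card_Diff_singleton mult.left_commute)
  then have "m - 1 \<le> 2 * (CARD('n) - k)" using m by simp
  then show ?thesis using kn by linarith
qed

section \<open>A cone partition that attains the bound\<close>

definition hits :: "'n expo \<Rightarrow> nat set" where
  "hits a = {i. i < m \<and> divides (u i) a}"

definition forced :: "'n expo \<Rightarrow> nat set" where
  "forced a = lower m (hits a)"

definition forbidden :: "'n expo \<Rightarrow> nat set" where
  "forbidden a = {..<m} - upper m (hits a)"

text \<open>
  Taking the first witness of non-divisibility keeps the cones disjoint: vectors with different
  pivots differ in whether the exponents before the later pivot are large enough.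
\<close>

definition pivot :: "'n expo \<Rightarrow> nat \<Rightarrow> 'n" where
  "pivot a j = arg_min to_nat (\<lambda>x. Poly_Mapping.lookup a x < Poly_Mapping.lookup (u j) x)"

definition pivots :: "'n expo \<Rightarrow> 'n set" where
  "pivots a = pivot a ` forbidden a"

text \<open>
  The variables at which all members of the block of \<open>a\<close> have at least the exponent of the generator
  that contains the variable: because the generator divides them, or because the variable
  comes before the pivot.
\<close>

definition full_at :: "'n expo \<Rightarrow> 'n \<Rightarrow> bool" where
  "full_at a x \<longleftrightarrow> (\<exists>i\<in>forced a. x \<in> Poly_Mapping.keys (u i)) \<or>
     (\<exists>j\<in>forbidden a. x \<in> Poly_Mapping.keys (u j) \<and> to_nat x < to_nat (pivot a j))"

text \<open>
  As the supports are disjoint, this is the exponent of \<open>x\<close> in the one generator that contains \<open>x\<close>, if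
  there is one. It spares the definition of the apex a choice of that generator.
\<close>

definition lcm_exponent :: "'n \<Rightarrow> nat" where
  "lcm_exponent x = (\<Sum>i<m. Poly_Mapping.lookup (u i) x)"

definition apex :: "'n expo \<Rightarrow> 'n expo" where
  "apex a = Abs_poly_mapping
     (\<lambda>x. if x \<in> pivots a then Poly_Mapping.lookup a x else if full_at a x then lcm_exponent x else 0)"

lemma lookup_apex:
  "Poly_Mapping.lookup (apex a) x =
     (if x \<in> pivots a then Poly_Mapping.lookup a x else if full_at a x then lcm_exponent x else 0)"
  unfolding apex_def by (simp add: lookup_Abs_poly_mapping)

lemma lcm_exponent_eq:
  assumes "i < m" "x \<in> Poly_Mapping.keys (u i)"
  shows "lcm_exponent x = Poly_Mapping.lookup (u i) x"
proof -
  have "Poly_Mapping.lookup (u j) x = 0" if "j < m" "j \<noteq> i" for j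
    using support_disjoint [OF assms(1) that(1) assms(2)] that(2) by (auto simp: in_keys_iff)
  then have "(\<Sum>j\<in>{..<m} - {i}. Poly_Mapping.lookup (u j) x) = 0"
    by (intro sum.neutral) auto
  then show ?thesis
    using assms(1) by (simp add: lcm_exponent_def sum.remove [of "{..<m}" i])
qed

lemma hits_subset: "hits a \<subseteq> {..<m}"
  by (auto simp: hits_def)

lemma hits_nonempty_iff: "hits a \<noteq> {} \<longleftrightarrow> a \<in> multiples"
  by (auto simp: hits_def multiples_def)

lemma forced_hits: "i \<in> forced a \<Longrightarrow> i < m \<and> divides (u i) a"
  using lower_subset [of m "hits a"] by (auto simp: forced_def hits_def)

lemma forbidden_less: "j \<in> forbidden a \<Longrightarrow> j < m"
  by (auto simp: forbidden_def)

lemma forbidden_not_hit: "j \<in> forbidden a \<Longrightarrow> \<not> divides (u j) a"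
  using subset_upper [OF hits_subset, of a] by (auto simp: forbidden_def hits_def)

lemma forced_not_forbidden: "i \<in> forced a \<Longrightarrow> i \<notin> forbidden a"
  using forced_hits forbidden_not_hit by blast

lemma pivot_less:
  assumes "j \<in> forbidden a"
  shows "Poly_Mapping.lookup a (pivot a j) < Poly_Mapping.lookup (u j) (pivot a j)"
proof -
  obtain x where "Poly_Mapping.lookup a x < Poly_Mapping.lookup (u j) x"
    using forbidden_not_hit [OF assms] by (auto simp: divides_def not_le)
  then show ?thesis unfolding pivot_def by (rule arg_min_natI)
qed

lemma pivot_in_keys: "j \<in> forbidden a \<Longrightarrow> pivot a j \<in> Poly_Mapping.keys (u j)"
  using pivot_less [of j a] by (simp add: in_keys_iff)

lemma before_pivot:
  assumes "to_nat x < to_nat (pivot a j)"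
  shows "Poly_Mapping.lookup (u j) x \<le> Poly_Mapping.lookup a x"
proof (rule ccontr)
  assume "\<not> ?thesis"
  then have "to_nat (pivot a j) \<le> to_nat x"
    unfolding pivot_def by (intro arg_min_nat_le) simp
  then show False using assms by simp
qed

text \<open>
  At a pivot the apex keeps the exponent of \<open>a\<close>, and elsewhere it asks only for what \<open>a\<close> has anyway.
\<close>

lemma in_apex_cone: "a \<in> cone (apex a) (- pivots a)"
proof -
  have "lcm_exponent x \<le> Poly_Mapping.lookup a x" if full: "full_at a x" for x
  proof -
    obtain i where "i < m" "x \<in> Poly_Mapping.keys (u i)"
      "Poly_Mapping.lookup (u i) x \<le> Poly_Mapping.lookup a x"
      using full forced_hits forbidden_less before_pivot unfolding full_at_def divides_def by metis
    then show ?thesis by (simp add: lcm_exponent_eq)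
  qed
  then show ?thesis by (simp add: cone_def lookup_apex)
qed

text \<open>
  A member \<open>b\<close> of the cone of \<open>a\<close> is still divisible by the generators in \<open>forced a\<close>, whose supports
  contain no pivot, and still fails at each pivot to be divisible by the generators in \<open>forbidden a\<close>.
  So its hits stay in the same interval. The pivots stay the same since before each of them the
  exponents remain large enough. The apex depends only on these data and on the exponents at the pivots,
  which are constant on the cone.
\<close>

lemma apex_cone_stable:
  assumes a: "a \<in> multiples" and b: "b \<in> cone (apex a) (- pivots a)"
  shows "b \<in> multiples" "apex b = apex a" "pivots b = pivots a"
proof -
  have ge: "Poly_Mapping.lookup (apex a) x \<le> Poly_Mapping.lookup b x" for x
    using b by (simp add: cone_def)
  have at_pivot: "Poly_Mapping.lookup b x = Poly_Mapping.lookup a x" if "x \<in> pivots a" for x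
    using b that by (simp add: cone_def lookup_apex)
  have only_pivot: "j \<in> forbidden a \<and> x = pivot a j"
    if "x \<in> pivots a" "j < m" "x \<in> Poly_Mapping.keys (u j)" for x j
    using that support_disjoint pivot_in_keys forbidden_less unfolding pivots_def by blast
  have "divides (u i) b" if i: "i \<in> forced a" for i
    unfolding divides_def
  proof
    fix x
    show "Poly_Mapping.lookup (u i) x \<le> Poly_Mapping.lookup b x"
    proof (cases "x \<in> Poly_Mapping.keys (u i)")
      case True
      have im: "i < m" using forced_hits [OF i] by simp
      have "x \<notin> pivots a" using only_pivot True im forced_not_forbidden [OF i] by blast
      moreover have "full_at a x" using i True by (auto simp: full_at_def)
      ultimately show ?thesis using ge [of x] lcm_exponent_eq [OF im True] by (simp add: lookup_apex)
    qed (simp add: in_keys_iff)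
  qed
  then have "forced a \<subseteq> hits b"
    using forced_hits unfolding hits_def by blast
  then have lo: "lower m (hits a) \<subseteq> hits b" by (simp only: forced_def)
  have "\<not> divides (u j) b" if j: "j \<in> forbidden a" for j
  proof -
    have "Poly_Mapping.lookup b (pivot a j) < Poly_Mapping.lookup (u j) (pivot a j)"
      using pivot_less [OF j] at_pivot [of "pivot a j"] j by (simp add: pivots_def)
    then show ?thesis unfolding divides_def by (metis not_le)
  qed
  then have "hits b \<inter> forbidden a = {}" unfolding hits_def by blast
  then have up: "hits b \<subseteq> upper m (hits a)"
    using hits_subset [of b] unfolding forbidden_def by blast
  have ne: "hits a \<noteq> {}" using a hits_nonempty_iff by blast
  note st = interval_stable [OF hits_subset ne lo up]
  show "b \<in> multiples" using st(1) hits_nonempty_iff by blast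
  have forced: "forced b = forced a" and forbidden: "forbidden b = forbidden a"
    using st by (simp_all add: forced_def forbidden_def)
  have pivot: "pivot b j = pivot a j" if j: "j \<in> forbidden a" for j
  proof -
    have jm: "j < m" using forbidden_less [OF j] .
    have "to_nat (pivot b j) = to_nat (pivot a j)"
      unfolding pivot_def [of b]
    proof (rule arg_min_equality)
      show "Poly_Mapping.lookup b (pivot a j) < Poly_Mapping.lookup (u j) (pivot a j)"
        using pivot_less [OF j] at_pivot [of "pivot a j"] j by (simp add: pivots_def)
    next
      fix x assume x: "Poly_Mapping.lookup b x < Poly_Mapping.lookup (u j) x"
      then have xk: "x \<in> Poly_Mapping.keys (u j)" by (simp add: in_keys_iff)
      show "to_nat (pivot a j) \<le> to_nat x"
      proof (rule ccontr)
        assume "\<not> ?thesis"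
        then have "to_nat x < to_nat (pivot a j)" by simp
        then have "full_at a x" and "x \<notin> pivots a"
          using j xk only_pivot [OF _ jm xk] by (auto simp: full_at_def)
        then show False using ge [of x] x lcm_exponent_eq [OF jm xk] by (simp add: lookup_apex)
      qed
    qed
    then show ?thesis by simp
  qed
  show piv: "pivots b = pivots a"
    unfolding pivots_def forbidden using pivot by (rule image_cong [OF refl])
  have "full_at b = full_at a"
    by (rule ext) (use pivot in \<open>auto simp: full_at_def forced forbidden\<close>)
  then show "apex b = apex a"
    by (intro poly_mapping_eqI) (simp add: lookup_apex piv at_pivot)
qed

lemma apex_le_lcm_exponent: "Poly_Mapping.lookup (apex a) x \<le> lcm_exponent x"
proof (cases "x \<in> pivots a")
  case True
  then obtain j where j: "j \<in> forbidden a" "x = pivot a j" by (auto simp: pivots_def)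
  then show ?thesis
    using pivot_less [OF j(1)] lcm_exponent_eq [OF forbidden_less pivot_in_keys] True
    by (simp add: lookup_apex less_imp_le)
qed (simp add: lookup_apex)

lemma finite_range_apex: "finite (range apex)"
proof -
  have "Poly_Mapping.lookup ` range apex \<subseteq> ((UNIV :: 'n set) \<rightarrow>\<^sub>E (\<Union>x. {..lcm_exponent x}))"
    using apex_le_lcm_exponent by fastforce
  moreover have "finite ((UNIV :: 'n set) \<rightarrow>\<^sub>E (\<Union>x. {..lcm_exponent x}))" by (intro finite_PiE) auto
  ultimately have "finite (Poly_Mapping.lookup ` range apex)" by (rule finite_subset)
  then show ?thesis
    by (rule finite_imageD) (simp add: inj_on_def poly_mapping_eqI)
qed

lemma card_pivots:
  assumes "a \<in> multiples"
  shows "card (pivots a) \<le> m div 2"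
proof -
  have "card (pivots a) \<le> card (forbidden a)"
    unfolding pivots_def by (intro card_image_le) (simp add: forbidden_def)
  also have "\<dots> \<le> m div 2"
    unfolding forbidden_def using assms hits_nonempty_iff by (intro card_above_upper hits_subset) blast
  finally show ?thesis .
qed

text \<open>
  The cones of all \<open>a\<close> partition the multiples by \<open>in_apex_cone\<close> and \<open>apex_cone_stable\<close>. Only finitely
  many occur because every apex divides the product of the generators.
\<close>

lemma ex_cone_partition:
  obtains D where "cone_partition multiples D"
    "\<And>v Z. (v, Z) \<in> D \<Longrightarrow> CARD('n) \<le> card Z + m div 2"
proof
  let ?D = "(\<lambda>a. (apex a, - pivots a)) ` multiples"
  have "finite ?D"
    by (rule finite_subset [of _ "range apex \<times> UNIV"]) (auto simp: finite_range_apex)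
  moreover have "cone v Z \<subseteq> multiples" if "(v, Z) \<in> ?D" for v Z
    using that apex_cone_stable(1) by blast
  moreover have "\<exists>!d. d \<in> ?D \<and> a \<in> cone (fst d) (snd d)" if a: "a \<in> multiples" for a
  proof (rule ex1I [of _ "(apex a, - pivots a)"])
    show "(apex a, - pivots a) \<in> ?D \<and> a \<in> cone (fst (apex a, - pivots a)) (snd (apex a, - pivots a))"
      using a in_apex_cone by simp
    fix d assume "d \<in> ?D \<and> a \<in> cone (fst d) (snd d)"
    then obtain b where b: "b \<in> multiples" "d = (apex b, - pivots b)" "a \<in> cone (apex b) (- pivots b)"
      by auto
    then show "d = (apex a, - pivots a)" using apex_cone_stable [OF b(1,3)] by simp
  qed
  ultimately show "cone_partition multiples ?D"
    unfolding cone_partition_def by (intro conjI ballI) (simp_all only: split_paired_all case_prod_conv)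
  show "CARD('n) \<le> card Z + m div 2" if vZ: "(v, Z) \<in> ?D" for v Z
  proof -
    obtain a where "a \<in> multiples" "Z = - pivots a" using vZ by auto
    then show ?thesis using card_pivots [of a] by (simp add: Compl_eq_Diff_UNIV card_Diff_subset)
  qed
qed

end

section \<open>The Stanley depth\<close>

theorem theorem2p4:
  fixes I :: "('n::finite, 'k::field) mpol set" and m :: nat
  assumes "complete_intersection I"
    and "card (min_gens I) = m"
    and "m \<ge> 1"
  shows "int (sdepth I) = int CARD('n) - \<lfloor>real m / 2\<rfloor>"
proof -
  obtain u where "coprime_exponents u m" and E: "exponents I = coprime_exponents.multiples u m"
    using complete_intersection_coprime_exponents [OF assms(1)] unfolding assms(2) by blast
  interpret coprime_exponents u m by fact
  have "monomial_ideal I" using assms(1) by (simp add: complete_intersection_def)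
  then have dec: "stanley_decomposition I D \<longleftrightarrow> cone_partition multiples D" for D
    unfolding E [symmetric] by (rule stanley_decomposition_iff)
  have "u 0 \<in> multiples" using assms(3) unfolding multiples_def divides_def
    by (intro CollectI exI [of _ 0]) simp
  then have nonempty: "finite D \<and> D \<noteq> {}" if "cone_partition multiples D" for D
    using that unfolding cone_partition_def by blast
  have bound: "sdepth_decomposition D + m div 2 \<le> CARD('n)" if D: "cone_partition multiples D" for D
  proof (rule cone_partition_bound [OF D assms(3)])
    fix v Z assume "(v, Z) \<in> D"
    then have "card Z \<in> (\<lambda>(v, Z). card Z) ` D" by force
    then show "sdepth_decomposition D \<le> card Z"
      using nonempty [OF D] unfolding sdepth_decomposition_def by (intro Min_le) auto
  qed
  obtain D where D: "cone_partition multiples D"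
    and big: "\<And>v Z. (v, Z) \<in> D \<Longrightarrow> CARD('n) \<le> card Z + m div 2"
    using ex_cone_partition by blast
  have "sdepth_decomposition D \<in> (\<lambda>(v, Z). card Z) ` D"
    using nonempty [OF D] unfolding sdepth_decomposition_def by (intro Min_in) auto
  then have "CARD('n) \<le> sdepth_decomposition D + m div 2" using big by auto
  then have opt: "sdepth_decomposition D = CARD('n) - m div 2" using bound [OF D] by simp
  have "sdepth I = CARD('n) - m div 2"
    unfolding sdepth_def dec
  proof (rule Max_eqI)
    show le: "k \<le> CARD('n) - m div 2"
      if k: "k \<in> {sdepth_decomposition D | D. cone_partition multiples D}" for k
    proof -
      obtain D' where "cone_partition multiples D'" "k = sdepth_decomposition D'" using k by blast
      then show ?thesis using bound [of D'] by simp
    qed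
    show "finite {sdepth_decomposition D | D. cone_partition multiples D}"
      unfolding finite_nat_set_iff_bounded_le using le by blast
    show "CARD('n) - m div 2 \<in> {sdepth_decomposition D | D. cone_partition multiples D}"
      unfolding opt [symmetric] using D by blast
  qed
  moreover have "m div 2 \<le> CARD('n)" using bound [OF D] by simp
  moreover have "\<lfloor>real m / 2\<rfloor> = int (m div 2)" by (metis floor_divide_of_nat_eq of_nat_numeral)
  ultimately show ?thesis by (simp add: of_nat_diff)
qed

end
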